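(* Let $p$ be an odd prime, $n\in\mathbb{Z}_p$ and $n\not\equiv 0,-16\pmod p$. Then $$\sum_{k=0}^{p-1}\binom{2k}{k}\frac{S_k}{(n+16)^k}\equiv \left(\frac{n(n+16)}{p}\right)\sum_{k=0}^{p-1}\frac{\binom{2k}{k}^2\binom{4k}{2k}}{n^{2k}}\pmod p.$$
   Context: $\mathbb{Z}_p$ denotes the set of rational numbers whose denominator is not divisible by $p$; congruences modulo $p$ are taken in this ring. $\left(\frac{a}{p}\right)$ is the Legendre symbol, which for $a\in\mathbb{Z}_p$ is the Legendre symbol of the residue of $a$ modulo $p$. For nonnegative integers $m$, $S_m=\sum_{k=0}^m\binom{m}{k}\binom{2k}{k}\binom{2m-2k}{m-k}$. *)

theory Defs
  imports Complex_Main "HOL-Number_Theory.Number_Theory"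
begin

definition p_integral :: "nat \<Rightarrow> rat set" where
  "p_integral p = {x. \<not> int p dvd snd (quotient_of x)}"

text \<open>Congruence modulo the ideal generated by \<open>p\<close> in the ring \<open>p_integral p\<close>;
  it is only ever true between elements of that ring.\<close>

definition p_cong :: "nat \<Rightarrow> rat \<Rightarrow> rat \<Rightarrow> bool" where
  "p_cong p x y \<longleftrightarrow>
     x \<in> p_integral p \<and> y \<in> p_integral p \<and> (\<exists>z \<in> p_integral p. x - y = of_nat p * z)"

text \<open>For prime \<open>p\<close> and \<open>x \<in> p_integral p\<close>; outside this domain the value is unspecified.\<close>

definition p_residue :: "nat \<Rightarrow> rat \<Rightarrow> int" where
  "p_residue p x = (THE r. 0 \<le> r \<and> r < int p \<and> p_cong p x (of_int r))"

definition p_Legendre :: "rat \<Rightarrow> nat \<Rightarrow> int" where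
  "p_Legendre x p = Legendre (p_residue p x) (int p)"

definition S :: "nat \<Rightarrow> nat" where
  "S m = (\<Sum>k=0..m. (m choose k) * ((2 * k) choose k) * ((2 * m - 2 * k) choose (m - k)))"

end

theory Submission
  imports Defs "HOL-Computational_Algebra.Polynomial"
    "HOL-Computational_Algebra.Formal_Power_Series"
begin

text \<open>
  Write \<open>p = 2 h + 1\<close> and \<open>y = 1 / (n + 16)\<close>. The idea is that modulo \<open>p\<close> the central binomial
  coefficient \<open>C(2k, k)\<close>, for \<open>k < p\<close>, is \<open>(-4)^k C(h, k)\<close> (lemma \<open>central_binomial_p_cong\<close>):
  over the rationals it equals \<open>(-4)^k C(-1/2, k)\<close>, and \<open>h\<close> is \<open>-1/2\<close> modulo \<open>p\<close>. Hence the
  left-hand sum is congruent to \<open>\<Sum>k. C(h, k) S_k (-4 y)^k\<close>, which is a terminating binomial sum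
  that can be evaluated exactly.

  For the evaluation, the numbers \<open>S_m\<close> are themselves a binomial transform (lemma \<open>S_eq_sum_even\<close>),
  \<open>S_m = \<Sum>r. C(2r, r)^2 C(m, 2r) 4^(m - 2r)\<close>,
  because their exponential generating function is the square of that of \<open>C(2k, k)\<close>, which is
  \<open>exp(2t) I(t)\<close> with \<open>I\<close> even. Inserting this, and summing over \<open>k\<close> first by the binomial theorem,
  gives (lemma \<open>sum_binomial_S\<close>)
  \<open>\<Sum>r. C(2r, r)^2 C(h, 2r) (16 y^2)^r (1 - 16 y)^(h - 2r)\<close>.
  Since \<open>1 - 16 y = n y\<close>, this is
  \<open>(n y)^h\<close> times \<open>\<Sum>r. C(2r, r)^2 16^r C(h, 2r) / n^(2r)\<close>.

  Now the congruence for central binomials is read backwards: \<open>16^r C(h, 2r)\<close> is \<open>C(4r, 2r)\<close> modulo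
  \<open>p\<close> for \<open>2 r < p\<close>, whereas for larger \<open>r < p\<close> the factor \<open>C(2r, r)\<close> vanishes modulo \<open>p\<close>. This
  produces the right-hand sum. Its coefficient \<open>(n y)^h\<close> differs from \<open>(n (n + 16))^h\<close> by the factor
  \<open>(n + 16)^(p - 1)\<close>, which is \<open>1\<close> by Fermat, so it is the Legendre symbol by Euler's criterion.
\<close>

section \<open>The numbers S as a binomial transform\<close>

lemma coeff_one_plus_square_power:
  "coeff ([:1, 0, 1:] ^ m) m = (if even m then of_nat (m choose (m div 2)) else (0::rat))"
proof -
  have "[:1, 0, 1:] = monom 1 2 + (1 :: rat poly)"
    by (simp add: monom_altdef numeral_2_eq_2 one_pCons)
  then have "[:1, 0, 1:] ^ m = (\<Sum>j\<le>m. monom (of_nat (m choose j)) (2 * j) :: rat poly)"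
    by (simp add: binomial_ring monom_power of_nat_poly mult.commute smult_monom)
  then have "coeff ([:1, 0, 1:] ^ m) m = (\<Sum>j\<le>m. if 2 * j = m then of_nat (m choose j) else (0::rat))"
    by (simp add: coeff_sum)
  also have "\<dots> = (\<Sum>j\<in>{j. j \<le> m \<and> 2 * j = m}. of_nat (m choose j))"
    by (subst sum.inter_filter [symmetric]) auto
  also have "{j. j \<le> m \<and> 2 * j = m} = (if even m then {m div 2} else {})"
    by auto
  finally show ?thesis by simp
qed

text \<open>Compare the coefficients of \<open>x^k\<close> in \<open>(1 + x)^(2k) = (2 x + (1 + x^2))^k\<close>.\<close>

lemma central_binomial_even_expansion:
  "of_nat ((2 * k) choose k) =
     (\<Sum>i\<le>k. of_nat (k choose i) * 2 ^ i *
        (if even (k - i) then of_nat ((k - i) choose ((k - i) div 2)) else (0::rat)))"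
proof -
  have "[:1, 1:] ^ (2 * k) = ([:0, 2:] + [:1, 0, 1:] :: rat poly) ^ k"
    by (simp add: power_mult power2_eq_square)
  also have "\<dots> = (\<Sum>i\<le>k. of_nat (k choose i) * [:0, 2:] ^ i * [:1, 0, 1:] ^ (k - i))"
    by (rule binomial_ring)
  also have "\<dots> = (\<Sum>i\<le>k. monom (of_nat (k choose i) * 2 ^ i) i * [:1, 0, 1:] ^ (k - i))"
  proof (rule sum.cong [OF refl])
    fix i
    have "[:0, 2:] = (monom 2 1 :: rat poly)" by (simp add: monom_altdef)
    then show "of_nat (k choose i) * [:0, 2:] ^ i * [:1, 0, 1:] ^ (k - i) =
        (monom (of_nat (k choose i) * 2 ^ i) i * [:1, 0, 1:] ^ (k - i) :: rat poly)"
      by (simp add: monom_power of_nat_poly smult_monom)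
  qed
  finally have "coeff ([:1, 1:] ^ (2 * k)) k =
      (\<Sum>i\<le>k. of_nat (k choose i) * 2 ^ i * coeff ([:1, 0, 1 :: rat:] ^ (k - i)) (k - i))"
    by (simp add: coeff_sum coeff_monom_mult)
  moreover have "coeff ([:1, 1 :: rat:] ^ (2 * k)) k = of_nat ((2 * k) choose k)"
    by (simp add: coeff_linear_poly_power)
  ultimately show ?thesis by (simp only: coeff_one_plus_square_power)
qed

definition central_egf :: "rat fps" where
  "central_egf = Abs_fps (\<lambda>k. of_nat ((2 * k) choose k) / fact k)"

text \<open>The series \<open>I_0(2t)\<close>, where \<open>I_0\<close> is the modified Bessel function of the first kind.\<close>

definition bessel_fps :: "rat fps" where
  "bessel_fps = Abs_fps (\<lambda>m. if even m then 1 / (fact (m div 2))\<^sup>2 else 0)"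

text \<open>The expansion \<open>central_binomial_even_expansion\<close> is a binomial convolution, so for exponential
  generating functions it is a product.\<close>

lemma central_egf_eq: "central_egf = fps_exp 2 * bessel_fps"
proof (rule fps_ext)
  fix k
  have "fps_nth central_egf k = (\<Sum>i\<le>k. of_nat (k choose i) * 2 ^ i *
        (if even (k - i) then of_nat ((k - i) choose ((k - i) div 2)) else 0)) / fact k"
    unfolding central_egf_def fps_nth_Abs_fps
    by (subst central_binomial_even_expansion) simp
  also have "\<dots> = (\<Sum>i\<le>k. 2 ^ i / fact i * fps_nth bessel_fps (k - i))"
    unfolding sum_divide_distrib
  proof (rule sum.cong [OF refl])
    fix i assume "i \<in> {..k}"
    then have i: "i \<le> k" by simp
    show "of_nat (k choose i) * 2 ^ i *
        (if even (k - i) then of_nat ((k - i) choose ((k - i) div 2)) else 0) / fact k =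
        2 ^ i / fact i * fps_nth bessel_fps (k - i)"
    proof (cases "even (k - i)")
      case True
      then obtain j where j: "k - i = 2 * j" by blast
      have "of_nat (k choose i) = (fact k / (fact i * fact (2 * j)) :: rat)"
        using binomial_fact [OF i, where 'a = rat] j by simp
      moreover have "of_nat ((2 * j) choose j) = (fact (2 * j) / (fact j * fact j) :: rat)"
        using binomial_fact [of j "2 * j", where 'a = rat] by simp
      ultimately show ?thesis
        using j by (simp add: bessel_fps_def power2_eq_square)
    qed (simp add: bessel_fps_def)
  qed
  finally show "fps_nth central_egf k = fps_nth (fps_exp 2 * bessel_fps) k"
    by (simp add: fps_mult_nth atLeast0AtMost)
qed

text \<open>The convolution of \<open>1 / j!^2\<close> with itself is \<open>\<Sum>j. C(r, j)^2 / r!^2\<close>, and the sum of the squares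
  of a row of Pascal's triangle is a central binomial coefficient.\<close>

lemma bessel_square_nth:
  "fps_nth (bessel_fps * bessel_fps) m =
     (if even m then of_nat ((m choose (m div 2))\<^sup>2) / fact m else 0)"
proof (cases "even m")
  case False
  then have "fps_nth bessel_fps i * fps_nth bessel_fps (m - i) = 0" if "i \<le> m" for i
    using that by (auto simp: bessel_fps_def)
  then have "fps_nth (bessel_fps * bessel_fps) m = 0"
    unfolding fps_mult_nth by (intro sum.neutral) auto
  with False show ?thesis by simp
next
  case True
  then obtain r where m: "m = 2 * r" by blast
  have "fps_nth (bessel_fps * bessel_fps) m =
      (\<Sum>i\<le>2 * r. fps_nth bessel_fps i * fps_nth bessel_fps (2 * r - i))"
    by (simp add: fps_mult_nth m atLeast0AtMost)
  also have "\<dots> = (\<Sum>i\<in>(*) 2 ` {..r}. fps_nth bessel_fps i * fps_nth bessel_fps (2 * r - i))"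
    by (rule sum.mono_neutral_right) (auto simp: bessel_fps_def image_iff elim!: evenE)
  also have "\<dots> = (\<Sum>j\<le>r. 1 / (fact j)\<^sup>2 * (1 / (fact (r - j))\<^sup>2))"
    by (subst sum.reindex) (auto simp: inj_on_def bessel_fps_def simp flip: diff_mult_distrib2)
  also have "\<dots> = (\<Sum>j\<le>r. of_nat ((r choose j)\<^sup>2) / (fact r)\<^sup>2)"
    by (rule sum.cong) (auto simp: binomial_fact power2_eq_square)
  also have "\<dots> = of_nat ((2 * r) choose r) / (fact r)\<^sup>2"
    by (simp only: choose_square_sum flip: sum_divide_distrib of_nat_sum)
  also have "\<dots> = of_nat (((2 * r) choose r)\<^sup>2) / fact (2 * r)"
    using binomial_fact [of r "2 * r", where 'a = rat] by (simp add: power2_eq_square)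
  finally show ?thesis by (simp add: m)
qed

text \<open>By definition \<open>S\<close> is the binomial convolution of \<open>C(2k, k)\<close> with itself, so its exponential
  generating function is \<open>(exp(2t) I_0(2t))^2 = I_0(2t)^2 exp(4t)\<close>; the claim is the coefficient
  form of the right-hand side. On the right, terms with \<open>2 r > m\<close> carry a truncated exponent, but
  there the binomial coefficient vanishes.\<close>

lemma S_eq_sum_even:
  "rat_of_nat (S m) =
     (\<Sum>r\<le>m. of_nat (((2 * r) choose r)\<^sup>2 * (m choose (2 * r))) * 4 ^ (m - 2 * r))"
proof -
  have fact_split: "fps_nth (A * B) m * fact m =
      (\<Sum>i\<le>m. of_nat (m choose i) * (fact i * fps_nth A i) * (fact (m - i) * fps_nth B (m - i)))"
    for A B :: "rat fps"
    by (simp add: fps_mult_nth atLeast0AtMost sum_distrib_right)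
       (auto intro!: sum.cong simp: binomial_fact)
  have "rat_of_nat (S m) = fps_nth (central_egf * central_egf) m * fact m"
    by (simp add: fact_split S_def central_egf_def atLeast0AtMost right_diff_distrib')
  also have "central_egf * central_egf = (bessel_fps * bessel_fps) * fps_exp 4"
    using fps_exp_add_mult [of "2 :: rat" 2] by (simp add: central_egf_eq mult_ac)
  also have "fps_nth \<dots> m * fact m = (\<Sum>i\<le>m. of_nat (m choose i) *
      (if even i then of_nat ((i choose (i div 2))\<^sup>2) else 0) * 4 ^ (m - i))"
    unfolding fact_split by (rule sum.cong) (auto simp: bessel_square_nth)
  also have "\<dots> = (\<Sum>i\<in>{i. i \<le> m \<and> even i}. of_nat (m choose i) *
      of_nat ((i choose (i div 2))\<^sup>2) * 4 ^ (m - i))"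
    by (rule sum.mono_neutral_cong_right) auto
  also have "\<dots> = (\<Sum>r\<in>{r. 2 * r \<le> m}. of_nat (((2 * r) choose r)\<^sup>2 * (m choose (2 * r))) * 4 ^ (m - 2 * r))"
    by (rule sum.reindex_bij_witness [of _ "(*) 2" "\<lambda>i. i div 2"]) auto
  also have "\<dots> = (\<Sum>r\<le>m. of_nat (((2 * r) choose r)\<^sup>2 * (m choose (2 * r))) * 4 ^ (m - 2 * r))"
    by (rule sum.mono_neutral_left) (auto simp: binomial_eq_0)
  finally show ?thesis .
qed

text \<open>Apart from the factor \<open>x^j\<close>, both sides are the \<open>j\<close>-th Hasse derivative
  of \<open>(1 + x)^h\<close>. The proof uses \<open>C(h, k) C(k, j) = C(h, j) C(h - j, k - j)\<close>.\<close>

lemma sum_binomial_binomial_power: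
  fixes x :: "'a :: comm_ring_1"
  shows "(\<Sum>k\<le>h. of_nat (h choose k) * of_nat (k choose j) * x ^ k) =
    of_nat (h choose j) * x ^ j * (1 + x) ^ (h - j)"
proof (cases "j \<le> h")
  case False
  then show ?thesis by (simp add: binomial_eq_0)
next
  case True
  have "(\<Sum>k\<le>h. of_nat (h choose k) * of_nat (k choose j) * x ^ k) =
      (\<Sum>k\<in>{j..h}. of_nat (h choose k) * of_nat (k choose j) * x ^ k)"
    by (rule sum.mono_neutral_right) (auto simp: binomial_eq_0)
  also have "\<dots> = (\<Sum>k\<in>{j..h}. of_nat ((h choose j) * ((h - j) choose (k - j))) * x ^ k)"
    by (rule sum.cong) (auto simp: choose_mult simp flip: of_nat_mult)
  also have "\<dots> = (\<Sum>i\<le>h - j. of_nat ((h choose j) * ((h - j) choose i)) * x ^ (i + j))"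
    by (rule sum.reindex_bij_witness [of _ "\<lambda>i. i + j" "\<lambda>k. k - j"]) (use True in auto)
  also have "\<dots> = of_nat (h choose j) * x ^ j * (x + 1) ^ (h - j)"
    by (simp add: binomial_ring sum_distrib_left power_add mult_ac)
  finally show ?thesis by (simp add: add.commute)
qed

text \<open>The transform of \<open>S_eq_sum_even\<close> is inserted and the sum over \<open>k\<close> carried out by
  \<open>sum_binomial_binomial_power\<close> at \<open>x = -16 y\<close>, the \<open>4^k\<close> having been absorbed into the power.\<close>

lemma sum_binomial_S:
  fixes y :: rat
  shows "(\<Sum>k\<le>h. of_nat (h choose k) * of_nat (S k) * (- 4 * y) ^ k) =
    (\<Sum>r\<le>h. of_nat (((2 * r) choose r)\<^sup>2 * (h choose (2 * r))) * (16 * y\<^sup>2) ^ r * (1 - 16 * y) ^ (h - 2 * r))"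
proof -
  have "(\<Sum>k\<le>h. of_nat (h choose k) * of_nat (S k) * (- 4 * y) ^ k) =
    (\<Sum>k\<le>h. \<Sum>r\<le>h. of_nat (((2 * r) choose r)\<^sup>2) / 16 ^ r *
       (of_nat (h choose k) * of_nat (k choose (2 * r)) * (- 16 * y) ^ k))"
  proof (rule sum.cong [OF refl])
    fix k assume "k \<in> {..h}"
    have "of_nat (S k) = (\<Sum>r\<le>h. of_nat (((2 * r) choose r)\<^sup>2 * (k choose (2 * r))) * (4 :: rat) ^ (k - 2 * r))"
      unfolding S_eq_sum_even using \<open>k \<in> {..h}\<close>
      by (intro sum.mono_neutral_left) (auto simp: binomial_eq_0)
    also have "\<dots> = (\<Sum>r\<le>h. of_nat (((2 * r) choose r)\<^sup>2) / 16 ^ r * of_nat (k choose (2 * r)) * 4 ^ k)"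
    proof (rule sum.cong [OF refl])
      fix r
      show "of_nat (((2 * r) choose r)\<^sup>2 * (k choose (2 * r))) * (4 :: rat) ^ (k - 2 * r) =
        of_nat (((2 * r) choose r)\<^sup>2) / 16 ^ r * of_nat (k choose (2 * r)) * 4 ^ k"
      proof (cases "2 * r \<le> k")
        case True
        then have "(4 :: rat) ^ k = 4 ^ (k - 2 * r) * 16 ^ r"
          by (simp add: power_diff power_mult)
        then show ?thesis by simp
      qed (simp add: binomial_eq_0)
    qed
    moreover have "(- 16 * y) ^ k = 4 ^ k * (- 4 * y) ^ k"
      by (simp flip: power_mult_distrib)
    ultimately show "of_nat (h choose k) * of_nat (S k) * (- 4 * y) ^ k = 
     (\<Sum>r\<le>h. of_nat (((2 * r) choose r)\<^sup>2) / 16 ^ r *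
       (of_nat (h choose k) * of_nat (k choose (2 * r)) * (- 16 * y) ^ k))"
      by (simp add: sum_distrib_left sum_distrib_right mult_ac)
  qed
  also have "\<dots> = (\<Sum>r\<le>h. of_nat (((2 * r) choose r)\<^sup>2) / 16 ^ r *
      (of_nat (h choose (2 * r)) * (- 16 * y) ^ (2 * r) * (1 + - 16 * y) ^ (h - 2 * r)))"
    by (subst sum.swap) (simp only: sum_binomial_binomial_power flip: sum_distrib_left)
  also have "\<dots> = (\<Sum>r\<le>h. of_nat (((2 * r) choose r)\<^sup>2 * (h choose (2 * r))) * (16 * y\<^sup>2) ^ r * (1 - 16 * y) ^ (h - 2 * r))"
  proof (rule sum.cong [OF refl])
    fix r
    have "(- 16 * y) ^ (2 * r) = (16 * (16 * y\<^sup>2)) ^ r"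
      by (subst power_mult) (simp add: power2_eq_square)
    then have "(- 16 * y) ^ (2 * r) = 16 ^ r * (16 * y\<^sup>2) ^ r"
      by (simp only: power_mult_distrib [of 16 "16 * y\<^sup>2"])
    then show "of_nat (((2 * r) choose r)\<^sup>2) / 16 ^ r *
      (of_nat (h choose (2 * r)) * (- 16 * y) ^ (2 * r) * (1 + - 16 * y) ^ (h - 2 * r)) =
      of_nat (((2 * r) choose r)\<^sup>2 * (h choose (2 * r))) * (16 * y\<^sup>2) ^ r * (1 - 16 * y) ^ (h - 2 * r)"
      by simp
  qed
  finally show ?thesis .
qed

section \<open>Congruences in the ring of p-integral rationals\<close>

text \<open>Ring operations do not preserve reduced fractions; this form frees the
  computations from them.\<close>

lemma p_integral_iff:
  "x \<in> p_integral p \<longleftrightarrow> (\<exists>a b. \<not> int p dvd b \<and> x = of_int a / of_int b)"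
proof
  assume "x \<in> p_integral p"
  then show "\<exists>a b. \<not> int p dvd b \<and> x = of_int a / of_int b"
    by (metis mem_Collect_eq p_integral_def prod.collapse quotient_of_div)
next
  assume "\<exists>a b. \<not> int p dvd b \<and> x = of_int a / of_int b"
  then obtain a b where b: "\<not> int p dvd b" and x: "x = of_int a / of_int b" by blast
  obtain c d where q: "quotient_of x = (c, d)" by fastforce
  then have d: "d > 0" and cd: "coprime c d" and "x = of_int c / of_int d"
    using quotient_of_denom_pos quotient_of_coprime quotient_of_div by blast+
  moreover have "b \<noteq> 0" using b by auto
  ultimately have "rat_of_int a * of_int d = of_int c * of_int b"
    using x by (simp add: field_simps)
  then have "a * d = c * b" by (metis of_int_eq_iff of_int_mult)
  then have "d dvd c * b" by (metis dvd_triv_right)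
  then have "d dvd b" using cd by (simp add: coprime_commute coprime_dvd_mult_right_iff)
  then show "x \<in> p_integral p" using b q by (auto simp: p_integral_def dest: dvd_trans)
qed

context
  fixes p :: nat
  assumes p: "prime p"
begin

lemma int_prime: "prime (int p)"
  using p by simp

lemma p_integral_of_int [simp]: "of_int a \<in> p_integral p"
  unfolding p_integral_iff using p
  by (intro exI [of _ a] exI [of _ 1]) (auto simp: prime_nat_iff)

lemma p_integral_of_nat [simp]: "of_nat a \<in> p_integral p"
  using p_integral_of_int [of "int a"] by simp

lemma p_integral_0 [simp]: "0 \<in> p_integral p"
  and p_integral_1 [simp]: "1 \<in> p_integral p"
  and p_integral_numeral [simp]: "numeral w \<in> p_integral p"
  using p_integral_of_int [of 0] p_integral_of_int [of 1] p_integral_of_int [of "numeral w"] by simp_all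

lemma p_integral_mult:
  assumes "x \<in> p_integral p" "y \<in> p_integral p"
  shows "x * y \<in> p_integral p"
proof -
  obtain a b c d where "\<not> int p dvd b" "x = of_int a / of_int b"
     "\<not> int p dvd d" "y = of_int c / of_int d"
    using assms unfolding p_integral_iff by blast
  then show ?thesis unfolding p_integral_iff using int_prime
    by (intro exI [of _ "a * c"] exI [of _ "b * d"]) (auto simp: prime_dvd_mult_iff)
qed

lemma p_integral_add:
  assumes "x \<in> p_integral p" "y \<in> p_integral p"
  shows "x + y \<in> p_integral p"
proof -
  obtain a b c d where *: "\<not> int p dvd b" "x = of_int a / of_int b"
     "\<not> int p dvd d" "y = of_int c / of_int d"
    using assms unfolding p_integral_iff by blast
  moreover from * have "b \<noteq> 0" "d \<noteq> 0" by auto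
  ultimately show ?thesis unfolding p_integral_iff using int_prime
    by (intro exI [of _ "a * d + c * b"] exI [of _ "b * d"])
       (auto simp: prime_dvd_mult_iff field_simps)
qed

lemma p_integral_uminus:
  "x \<in> p_integral p \<Longrightarrow> - x \<in> p_integral p"
  using p_integral_mult [of "of_int (- 1)" x, OF p_integral_of_int] by simp

lemma p_integral_power: "x \<in> p_integral p \<Longrightarrow> x ^ k \<in> p_integral p"
  by (induction k) (auto intro: p_integral_mult)

text \<open>The ring is local: what lies outside the ideal generated by \<open>p\<close> is a unit.\<close>

lemma p_integral_inverse:
  assumes "x \<in> p_integral p" "\<not> p_cong p x 0"
  shows "inverse x \<in> p_integral p"
proof -
  obtain a b where b: "\<not> int p dvd b" and x: "x = of_int a / of_int b"
    using assms unfolding p_integral_iff by blast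
  have "\<not> int p dvd a"
  proof
    assume "int p dvd a"
    then obtain c where "a = int p * c" by blast
    with x have "x - 0 = of_nat p * (of_int c / of_int b)" by simp
    moreover have "of_int c / of_int b \<in> p_integral p"
      using b p_integral_iff by blast
    ultimately have "p_cong p x 0"
      using assms(1) p_integral_0 unfolding p_cong_def by blast
    with assms(2) show False by blast
  qed
  then show ?thesis unfolding p_integral_iff x
    by (intro exI [of _ b] exI [of _ a]) auto
qed

lemma p_cong_refl: "x \<in> p_integral p \<Longrightarrow> p_cong p x x"
  unfolding p_cong_def by (auto intro: bexI [of _ 0])

lemma p_cong_sym:
  assumes "p_cong p x y"
  shows "p_cong p y x"
proof -
  obtain z where z: "z \<in> p_integral p" "x - y = of_nat p * z"
    using assms unfolding p_cong_def by blast
  have "y - x = - (x - y)" by simp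
  also have "\<dots> = of_nat p * (- z)" by (simp add: z)
  finally show ?thesis using assms z p_integral_uminus unfolding p_cong_def by blast
qed

lemma p_cong_add:
  assumes "p_cong p x y" "p_cong p u v"
  shows "p_cong p (x + u) (y + v)"
proof -
  obtain z w where *: "z \<in> p_integral p" "x - y = of_nat p * z"
      "w \<in> p_integral p" "u - v = of_nat p * w"
    using assms unfolding p_cong_def by blast
  then have "(x + u) - (y + v) = of_nat p * (z + w)"
    by (simp add: algebra_simps)
  then show ?thesis using assms * p_integral_add unfolding p_cong_def by blast
qed

lemma p_cong_mult:
  assumes "p_cong p x y" "p_cong p u v"
  shows "p_cong p (x * u) (y * v)"
proof -
  obtain z w where *: "z \<in> p_integral p" "x - y = of_nat p * z"
      "w \<in> p_integral p" "u - v = of_nat p * w"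
    using assms unfolding p_cong_def by blast
  have "x * u - y * v = (x - y) * u + y * (u - v)" by (simp add: algebra_simps)
  also have "\<dots> = of_nat p * (z * u + y * w)" by (simp add: * algebra_simps)
  finally show ?thesis
    using assms * p_integral_add p_integral_mult unfolding p_cong_def by blast
qed

lemma p_cong_trans [trans]:
  assumes "p_cong p x y" "p_cong p y u"
  shows "p_cong p x u"
proof -
  obtain z w where *: "z \<in> p_integral p" "x - y = of_nat p * z"
      "w \<in> p_integral p" "y - u = of_nat p * w"
    using assms unfolding p_cong_def by blast
  then have "x - u = of_nat p * (z + w)" by (simp add: algebra_simps)
  then show ?thesis using assms * p_integral_add unfolding p_cong_def by blast
qed

lemma p_cong_power: "p_cong p x y \<Longrightarrow> p_cong p (x ^ k) (y ^ k)"
  by (induction k) (auto intro: p_cong_mult p_cong_refl)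

lemma p_cong_sum:
  "(\<And>k. k \<in> A \<Longrightarrow> p_cong p (f k) (g k)) \<Longrightarrow> p_cong p (sum f A) (sum g A)"
  by (induction A rule: infinite_finite_induct) (auto intro: p_cong_add p_cong_refl)

lemma p_cong_of_int: "[a = b] (mod int p) \<Longrightarrow> p_cong p (of_int a) (of_int b)"
proof -
  assume "[a = b] (mod int p)"
  then obtain c where "a - b = int p * c" by (auto simp: cong_iff_dvd_diff)
  then have "rat_of_int a - of_int b = of_nat p * of_int c"
    by (metis of_int_diff of_int_mult of_int_of_nat_eq)
  then show ?thesis unfolding p_cong_def by auto
qed

lemma p_cong_of_int_iff: "p_cong p (of_int a) (of_int b) \<longleftrightarrow> [a = b] (mod int p)"
proof
  assume "p_cong p (of_int a) (of_int b)"
  then obtain z where "z \<in> p_integral p" and z: "rat_of_int a - of_int b = of_nat p * z"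
    unfolding p_cong_def by blast
  then obtain c d where d: "\<not> int p dvd d" and "z = of_int c / of_int d"
    unfolding p_integral_iff by blast
  moreover have "d \<noteq> 0" using d by auto
  ultimately have "(rat_of_int a - of_int b) * of_int d = of_nat p * of_int c"
    using z by (simp add: field_simps)
  then have "rat_of_int ((a - b) * d) = of_int (int p * c)" by simp
  then have "(a - b) * d = int p * c" using of_int_eq_iff by blast
  then have "int p dvd (a - b) * d" by simp
  then have "int p dvd a - b" using d int_prime by (simp add: prime_dvd_mult_iff)
  then show "[a = b] (mod int p)" by (simp add: cong_iff_dvd_diff)
qed (rule p_cong_of_int)

text \<open>The residue field of the ring is that of the integers. This carries the theorems of Fermat and
  Euler over from the integers.\<close>

lemma ex_int_p_cong:
  assumes "x \<in> p_integral p"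
  shows "\<exists>c. p_cong p x (of_int c)"
proof -
  obtain a b where b: "\<not> int p dvd b" and x: "x = of_int a / of_int b"
    using assms unfolding p_integral_iff by blast
  have "coprime b (int p)"
    using b int_prime prime_imp_coprime coprime_commute by blast
  then obtain b' where "[b * b' = 1] (mod int p)"
    using cong_solve_coprime_int by blast
  then obtain d where "1 - b * b' = int p * d"
    by (metis cong_iff_dvd_diff cong_sym dvd_def)
  then have d: "1 - rat_of_int b * of_int b' = of_nat p * of_int d"
    by (metis of_int_1 of_int_diff of_int_mult of_int_of_nat_eq)
  have "b \<noteq> 0" using b by auto
  \<comment> \<open>The representative is \<open>a b'\<close>, where \<open>b'\<close> inverts the denominator \<open>b\<close> modulo \<open>p\<close>.\<close>
  then have "x - of_int (a * b') = x * (1 - of_int b * of_int b')"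
    by (simp add: x field_simps)
  also have "\<dots> = of_nat p * (x * of_int d)" by (simp add: d)
  finally show ?thesis
    using assms p_integral_mult [OF assms p_integral_of_int] p_integral_of_int
    unfolding p_cong_def by blast
qed

lemma p_residue_p_cong:
  assumes "x \<in> p_integral p"
  shows "p_cong p x (of_int (p_residue p x))"
proof -
  obtain c where c: "p_cong p x (of_int c)" using ex_int_p_cong assms by blast
  have "p > 0" using p prime_gt_0_nat by blast
  have "\<exists>!r. 0 \<le> r \<and> r < int p \<and> p_cong p x (of_int r)"
  proof (rule ex1I [of _ "c mod int p"])
    have "p_cong p (of_int c) (of_int (c mod int p))"
      by (rule p_cong_of_int) (simp add: cong_def)
    with c have "p_cong p x (of_int (c mod int p))" by (rule p_cong_trans)
    then show "0 \<le> c mod int p \<and> c mod int p < int p \<and> p_cong p x (of_int (c mod int p))"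
      using \<open>p > 0\<close> by simp
  next
    fix r assume r: "0 \<le> r \<and> r < int p \<and> p_cong p x (of_int r)"
    then have "p_cong p (of_int r) (of_int c)" using c p_cong_sym p_cong_trans by blast
    then show "r = c mod int p" using r unfolding p_cong_of_int_iff cong_def by simp
  qed
  from theI' [OF this] show ?thesis unfolding p_residue_def by blast
qed

section \<open>Fermat, Euler and central binomials\<close>

lemma fermat_p_cong:
  assumes "x \<in> p_integral p" "\<not> p_cong p x 0"
  shows "p_cong p (x ^ (p - 1)) 1"
proof -
  obtain c where c: "p_cong p x (of_int c)" using ex_int_p_cong assms by blast
  define m where "m = nat (c mod int p)"
  have "p > 0" using p prime_gt_0_nat by blast
  then have "int m = c mod int p" by (simp add: m_def)
  then have "[c = int m] (mod int p)" by (simp add: cong_def)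
  then have "p_cong p (of_int c) (of_int (int m))" by (rule p_cong_of_int)
  with c have m: "p_cong p x (of_int (int m))" by (rule p_cong_trans)
  have "\<not> p dvd m"
  proof
    assume "p dvd m"
    then have "p_cong p (of_int (int m)) (of_int 0)"
      by (intro p_cong_of_int) (simp add: cong_0_iff)
    with m assms(2) show False using p_cong_trans by fastforce
  qed
  with p have "[m ^ (p - 1) = 1] (mod p)" by (rule fermat_theorem)
  then have "[int m ^ (p - 1) = 1] (mod int p)"
    by (metis cong_int_iff of_nat_1 of_nat_power)
  then have "p_cong p (of_int (int m) ^ (p - 1)) 1" using p_cong_of_int by fastforce
  with p_cong_power [OF m] show ?thesis by (rule p_cong_trans)
qed

lemma euler_p_cong:
  assumes "odd p" "x \<in> p_integral p"
  shows "p_cong p (of_int (p_Legendre x p)) (x ^ ((p - 1) div 2))"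
proof -
  have "2 < p" using assms(1) p by (metis even_numeral le_neq_implies_less prime_ge_2_nat)
  have "[Legendre (p_residue p x) (int p) = p_residue p x ^ ((p - 1) div 2)] (mod int p)"
    using euler_criterion p \<open>2 < p\<close> by blast
  then have "p_cong p (of_int (p_Legendre x p)) (of_int (p_residue p x) ^ ((p - 1) div 2))"
    unfolding p_Legendre_def using p_cong_of_int by fastforce
  also have "p_cong p \<dots> (x ^ ((p - 1) div 2))"
    using p_cong_power p_cong_sym p_residue_p_cong assms(2) by blast
  finally show ?thesis .
qed

text \<open>Both sides satisfy the same first-order recurrence modulo \<open>p\<close>: the quotient of consecutive
  terms is \<open>2 (2k + 1) / (k + 1)\<close> on the left and \<open>-4 (h - k) / (k + 1)\<close> on the right, and
  \<open>-4 h\<close> is \<open>2\<close> modulo \<open>p\<close>. The bound \<open>k < p\<close> keeps the denominators invertible. For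
  \<open>h < k < p\<close> the right-hand side is \<open>0\<close>, so the lemma also says that \<open>p\<close> divides \<open>C(2k, k)\<close>
  there.\<close>

lemma central_binomial_p_cong:
  assumes "p = 2 * h + 1" "k < p"
  shows "p_cong p (of_nat ((2 * k) choose k)) ((- 4) ^ k * of_nat (h choose k))"
proof -
  have "[int ((2 * k) choose k) = (- 4) ^ k * int (h choose k)] (mod int p)"
    using assms(2)
  proof (induction k)
    case 0
    then show ?case by simp
  next
    case (Suc k)
    have central: "int (Suc k) * int ((2 * Suc k) choose Suc k) = 2 * (2 * int k + 1) * int ((2 * k) choose k)"
    proof -
      have "Suc k * ((2 * Suc k) choose Suc k) = Suc (2 * k + 1) * ((2 * k + 1) choose k)"
        using Suc_times_binomial_eq [of "2 * k + 1" k] by simp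
      also have "\<dots> = 2 * (Suc k * (Suc (2 * k) choose Suc k))"
        using binomial_symmetric [of k "2 * k + 1"] by simp
      also have "Suc k * (Suc (2 * k) choose Suc k) = Suc (2 * k) * ((2 * k) choose k)"
        using Suc_times_binomial_eq [of "2 * k" k] by simp
      finally have "Suc k * ((2 * Suc k) choose Suc k) = 2 * (2 * k + 1) * ((2 * k) choose k)"
        by simp
      then show ?thesis by (metis (mono_tags) int_ops(2) int_ops(7) int_plus of_nat_numeral)
    qed
    have half: "int (Suc k) * int (h choose Suc k) = (int h - int k) * int (h choose k)"
    proof (cases "k \<le> h")
      case True
      have "Suc k * (h choose Suc k) = (h - k) * (h choose k)"
        using binomial_absorption [of k h] binomial_absorb_comp [of h k] by simp
      then show ?thesis using True by (metis of_nat_diff of_nat_mult)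
    qed (simp add: binomial_eq_0)
    have "int (Suc k) * ((- 4) ^ Suc k * int (h choose Suc k)) =
        (- 4) * (int h - int k) * ((- 4) ^ k * int (h choose k))"
    proof -
      have "int (Suc k) * ((- 4) ^ Suc k * int (h choose Suc k)) =
          (- 4) * (- 4) ^ k * (int (Suc k) * int (h choose Suc k))"
        by (simp only: power_Suc mult_ac)
      then show ?thesis by (simp only: half mult_ac)
    qed
    also have "[\<dots> = 2 * (2 * int k + 1) * ((- 4) ^ k * int (h choose k))] (mod int p)"
    proof (rule cong_scalar_right)
      have "(- 4) * (int h - int k) - 2 * (2 * int k + 1) = int p * (- 2)"
        using assms(1) by simp
      then show "[(- 4) * (int h - int k) = 2 * (2 * int k + 1)] (mod int p)"
        unfolding cong_iff_dvd_diff by simp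
    qed
    also have "[2 * (2 * int k + 1) * ((- 4) ^ k * int (h choose k)) =
        2 * (2 * int k + 1) * int ((2 * k) choose k)] (mod int p)"
      using Suc by (intro cong_scalar_left cong_sym [OF Suc.IH]) simp
    finally have "[int (Suc k) * int ((2 * Suc k) choose Suc k) =
        int (Suc k) * ((- 4) ^ Suc k * int (h choose Suc k))] (mod int p)"
      unfolding central by (rule cong_sym)
    moreover have "coprime (int (Suc k)) (int p)"
    proof -
      have "\<not> p dvd Suc k" using Suc.prems by (auto dest: dvd_imp_le)
      then show ?thesis
        using p prime_imp_coprime coprime_commute coprime_int_iff by blast
    qed
    ultimately show ?case using cong_mult_lcancel by blast
  qed
  then show ?thesis using p_cong_of_int by fastforce
qed

end

section \<open>The transformation of the sum\<close>

theorem theorem3p6: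
  fixes p :: nat and n :: rat
  assumes "prime p" and "odd p"
    and "n \<in> p_integral p"
    and "\<not> p_cong p n 0" and "\<not> p_cong p n (- 16)"
  shows "p_cong p
    (\<Sum>k=0..p - 1. of_nat ((2 * k) choose k) * of_nat (S k) / (n + 16) ^ k)
    (of_int (p_Legendre (n * (n + 16)) p) *
      (\<Sum>k=0..p - 1. of_nat (((2 * k) choose k)\<^sup>2 * ((4 * k) choose (2 * k))) / n ^ (2 * k)))"
proof -
  note p = assms(1)
  note [trans] = p_cong_trans [OF p]
  define h where "h = (p - 1) div 2"
  have ph: "p = 2 * h + 1" using assms(2) by (auto simp: h_def elim!: oddE)
  have n16: "n + 16 \<in> p_integral p" using assms p_integral_add [OF p] p_integral_numeral [OF p] by blast
  have unit: "\<not> p_cong p (n + 16) 0"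
  proof
    assume "p_cong p (n + 16) 0"
    then have "p_cong p (n + 16 + of_int (- 16)) (0 + of_int (- 16))"
      by (intro p_cong_add [OF p] p_cong_refl [OF p] p_integral_of_int [OF p])
    with assms(5) show False by simp
  qed
  have "n \<noteq> 0" "n + 16 \<noteq> 0"
    using assms(4) unit p_cong_refl [OF p] p_integral_0 [OF p] by auto
  define y where "y = inverse (n + 16)"
  have y: "y \<in> p_integral p" unfolding y_def by (rule p_integral_inverse [OF p n16 unit])
  have yn: "y * (n + 16) = 1" using \<open>n + 16 \<noteq> 0\<close> by (simp add: y_def)
  then have ny: "1 - 16 * y = n * y" by (simp add: algebra_simps)
  have "y \<noteq> 0" using yn by auto
  have in_inv: "inverse n \<in> p_integral p"
    by (rule p_integral_inverse [OF p assms(3,4)])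
  define c where "c r = rat_of_nat (((2 * r) choose r)\<^sup>2)" for r
  define T where "T = (\<Sum>k=0..p - 1. of_nat (((2 * k) choose k)\<^sup>2 * ((4 * k) choose (2 * k))) / n ^ (2 * k))"
  have "p_cong p (\<Sum>k=0..p - 1. of_nat ((2 * k) choose k) * of_nat (S k) / (n + 16) ^ k)
      (\<Sum>k=0..p - 1. of_nat (h choose k) * of_nat (S k) * (- 4 * y) ^ k)"
  proof (rule p_cong_sum [OF p])
    fix k assume "k \<in> {0..p - 1}"
    then have "k < p" using ph by auto
    have "p_cong p (of_nat ((2 * k) choose k) * (of_nat (S k) * y ^ k))
        ((- 4) ^ k * of_nat (h choose k) * (of_nat (S k) * y ^ k))"
      by (intro p_cong_mult [OF p] central_binomial_p_cong [OF p ph \<open>k < p\<close>] p_cong_refl [OF p]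
          p_integral_mult [OF p] p_integral_power [OF p] p_integral_of_nat [OF p] y)
    moreover have "of_nat ((2 * k) choose k) * (of_nat (S k) * y ^ k) =
        of_nat ((2 * k) choose k) * of_nat (S k) / (n + 16) ^ k"
      by (simp add: y_def power_inverse field_simps)
    moreover have "(- 4) ^ k * of_nat (h choose k) * (of_nat (S k) * y ^ k) =
        of_nat (h choose k) * of_nat (S k) * (- 4 * y) ^ k"
      by (simp only: power_mult_distrib mult_ac)
    ultimately show "p_cong p (of_nat ((2 * k) choose k) * of_nat (S k) / (n + 16) ^ k)
      (of_nat (h choose k) * of_nat (S k) * (- 4 * y) ^ k)" by simp
  qed
  \<comment> \<open>The sum now stops at \<open>h\<close>, so the exact evaluation applies.\<close>
  also have "(\<Sum>k=0..p - 1. of_nat (h choose k) * of_nat (S k) * (- 4 * y) ^ k) =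
      (\<Sum>k\<le>h. of_nat (h choose k) * of_nat (S k) * (- 4 * y) ^ k)"
    by (rule sum.mono_neutral_right) (auto simp: ph binomial_eq_0)
  also have "\<dots> = (\<Sum>r\<le>h. c r * of_nat (h choose (2 * r)) * (16 * y\<^sup>2) ^ r * (n * y) ^ (h - 2 * r))"
    unfolding sum_binomial_S ny c_def by simp
  also have "\<dots> = (\<Sum>r\<le>h. (n * y) ^ h * (c r * (16 ^ r * of_nat (h choose (2 * r))) * inverse n ^ (2 * r)))"
  proof (rule sum.cong [OF refl])
    fix r
    show "c r * of_nat (h choose (2 * r)) * (16 * y\<^sup>2) ^ r * (n * y) ^ (h - 2 * r) =
      (n * y) ^ h * (c r * (16 ^ r * of_nat (h choose (2 * r))) * inverse n ^ (2 * r))"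
    proof (cases "2 * r \<le> h")
      case True
      then have "(n * y) ^ h = (n * y) ^ (h - 2 * r) * (n * y) ^ (2 * r)"
        by (simp flip: power_add)
      moreover have "(n * y) ^ (2 * r) * inverse n ^ (2 * r) = (y\<^sup>2) ^ r"
      proof -
        have "n * y * inverse n = y" using \<open>n \<noteq> 0\<close> by simp
        then show ?thesis by (simp only: power_mult flip: power_mult_distrib)
      qed
      ultimately show ?thesis by (simp add: power_mult_distrib mult_ac)
    qed (simp add: binomial_eq_0)
  qed
  \<comment> \<open>The range is extended back to \<open>p - 1\<close> to compare with the right-hand sum term by term; the
    added terms are \<open>0\<close>.\<close>
  also have "\<dots> = (n * y) ^ h * (\<Sum>r=0..p - 1. c r * (16 ^ r * of_nat (h choose (2 * r))) * inverse n ^ (2 * r))"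
    unfolding sum_distrib_left by (rule sum.mono_neutral_left) (auto simp: ph binomial_eq_0)
  also have "p_cong p \<dots> (of_int (p_Legendre (n * (n + 16)) p) * T)"
  proof (rule p_cong_mult [OF p])
    have "p_cong p (of_int (p_Legendre (n * (n + 16)) p)) ((n * (n + 16)) ^ h)"
      unfolding h_def by (intro euler_p_cong [OF p assms(2)] p_integral_mult [OF p] assms n16)
    also have "(n * (n + 16)) ^ h = (n * y) ^ h * (n + 16) ^ (p - 1)"
    \<comment> \<open>\<open>n (n + 16)\<close> and \<open>n y\<close> differ by a square, so they have the same quadratic character.\<close>
    proof -
      have "n * (n + 16) = (n * y) * (n + 16)\<^sup>2"
        using yn by (simp add: power2_eq_square)
      then have "(n * (n + 16)) ^ h = (n * y) ^ h * (n + 16) ^ (2 * h)"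
        by (simp only: power_mult_distrib power_mult)
      then show ?thesis by (simp add: ph)
    qed
    also have "p_cong p \<dots> ((n * y) ^ h * 1)"
      by (intro p_cong_mult [OF p] p_cong_refl [OF p] fermat_p_cong [OF p n16 unit]
          p_integral_power [OF p] p_integral_mult [OF p] assms y)
    finally show "p_cong p ((n * y) ^ h) (of_int (p_Legendre (n * (n + 16)) p))"
      using p_cong_sym [OF p] by simp
  next
    show "p_cong p (\<Sum>r=0..p - 1. c r * (16 ^ r * of_nat (h choose (2 * r))) * inverse n ^ (2 * r)) T"
      unfolding T_def
    proof (rule p_cong_sum [OF p])
      fix r assume r: "r \<in> {0..p - 1}"
      then have "r < p" using ph by auto
      have "p_cong p (c r * (16 ^ r * of_nat (h choose (2 * r)))) (c r * of_nat ((4 * r) choose (2 * r)))"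
      \<comment> \<open>For \<open>r \<le> h\<close> the index \<open>2 r\<close> is still below \<open>p\<close>; beyond that, \<open>c r\<close> vanishes modulo \<open>p\<close>.\<close>
      proof (cases "r \<le> h")
        case True
        then have "p_cong p (of_nat ((2 * (2 * r)) choose (2 * r))) ((- 4) ^ (2 * r) * of_nat (h choose (2 * r)))"
          by (intro central_binomial_p_cong [OF p ph]) (simp add: ph)
        then have "p_cong p (16 ^ r * of_nat (h choose (2 * r))) (of_nat ((4 * r) choose (2 * r)))"
          using p_cong_sym [OF p] by (simp add: power_mult)
        then show ?thesis
          by (intro p_cong_mult [OF p] p_cong_refl [OF p])
               (auto simp only: c_def intro: p_integral_of_nat [OF p])
      next
        case False
        have "p_cong p (of_nat ((2 * r) choose r)) 0"
          using central_binomial_p_cong [OF p ph \<open>r < p\<close>] False by (simp add: binomial_eq_0)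
        from p_cong_power [OF p this, of 2] have "p_cong p (c r) 0" by (simp add: c_def)
        then have "p_cong p (c r * of_nat ((4 * r) choose (2 * r))) (0 * of_nat ((4 * r) choose (2 * r)))"
          by (intro p_cong_mult [OF p] p_cong_refl [OF p] p_integral_of_nat [OF p])
        then show ?thesis using False p_cong_sym [OF p] by (simp add: binomial_eq_0)
      qed
      then have "p_cong p (c r * (16 ^ r * of_nat (h choose (2 * r))) * inverse n ^ (2 * r))
         (c r * of_nat ((4 * r) choose (2 * r)) * inverse n ^ (2 * r))"
        by (rule p_cong_mult [OF p]) (intro p_cong_refl [OF p] p_integral_power [OF p] in_inv)
      moreover have "c r * of_nat ((4 * r) choose (2 * r)) * inverse n ^ (2 * r) =
          of_nat (((2 * r) choose r)\<^sup>2 * ((4 * r) choose (2 * r))) / n ^ (2 * r)"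
        by (simp add: c_def power_inverse divide_inverse)
      ultimately show "p_cong p (c r * (16 ^ r * of_nat (h choose (2 * r))) * inverse n ^ (2 * r))
         (of_nat (((2 * r) choose r)\<^sup>2 * ((4 * r) choose (2 * r))) / n ^ (2 * r))" by simp
    qed
  qed
  finally show ?thesis unfolding T_def .
qed

end
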